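(* Let $p$ be a prime and $n\ge 1$. If $N\trianglelefteq P_n$ is a normal subgroup of depth $j$, then $[T_j,T_j]\le N$.
   Context: $P_n$ is the following Sylow $p$-subgroup of $S_{p^n}=\operatorname{Sym}(\mathbb{F}_p^n)$. For $0\le i\le n-1$ let $\sigma_i\in\operatorname{Sym}(\mathbb{F}_p^n)$ be the permutation which sends $(\lambda_0,\ldots,\lambda_{n-1})$ to $(\lambda_0,\ldots,\lambda_{i-1},\lambda_i+1,\lambda_{i+1},\ldots,\lambda_{n-1})$ if $\lambda_0=\cdots=\lambda_{i-1}=0$, and fixes $(\lambda_0,\ldots,\lambda_{n-1})$ otherwise. Put $P_n=\langle\sigma_0,\ldots,\sigma_{n-1}\rangle$; it is the $n$-fold iterated wreath product of $C_p$. For $0\le j\le n$ one has $P_n\cong P_{n-j}\wr P_j$, and $T_j\cong (P_{n-j})^{p^j}$ denotes the base group of this wreath product; equivalently $T_j$ is the subgroup of all elements of $P_n$ that leave the first $j$ coordinates $\lambda_0,\ldots,\lambda_{j-1}$ of every point unchanged. Thus $P_n=T_0>T_1>\cdots>T_n=1$. The depth of a subgroup $S\le P_n$ is the largest $i\in\{0,\ldots,n\}$ with $S\le T_i$. *)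

theory Defs
  imports "HOL-Number_Theory.Residues" "HOL-Algebra.Bij" "HOL-Algebra.Generated_Groups"
begin

text \<open>
  The vector space \<open>F_p^n\<close>: coordinates are indexed by \<open>0, ..., n - 1\<close>, and a vector is an
  extensional function, so that it is determined by its coordinates.
\<close>

definition points :: "nat \<Rightarrow> nat \<Rightarrow> (nat \<Rightarrow> int) set" where
  "points p n = {..<n} \<rightarrow>\<^sub>E carrier (residue_ring (int p))"

definition sigma :: "nat \<Rightarrow> nat \<Rightarrow> nat \<Rightarrow> (nat \<Rightarrow> int) \<Rightarrow> (nat \<Rightarrow> int)" where
  "sigma p n i = (\<lambda>v \<in> points p n.
     if \<forall>k<i. v k = \<zero>\<^bsub>residue_ring (int p)\<^esub>
     then v(i := v i \<oplus>\<^bsub>residue_ring (int p)\<^esub> \<one>\<^bsub>residue_ring (int p)\<^esub>) else v)"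

definition P :: "nat \<Rightarrow> nat \<Rightarrow> ((nat \<Rightarrow> int) \<Rightarrow> (nat \<Rightarrow> int)) monoid" where
  "P p n = (BijGroup (points p n))
     \<lparr>carrier := generate (BijGroup (points p n)) (sigma p n ` {..<n})\<rparr>"

text \<open>
  The base group \<open>T_j\<close> of the wreath product decomposition of \<open>P_n\<close> at level \<open>j\<close>, described as
  the subgroup of the elements that leave the first \<open>j\<close> coordinates of every point unchanged.
\<close>

definition T :: "nat \<Rightarrow> nat \<Rightarrow> nat \<Rightarrow> ((nat \<Rightarrow> int) \<Rightarrow> (nat \<Rightarrow> int)) set" where
  "T p n j = {g \<in> carrier (P p n). \<forall>v \<in> points p n. \<forall>k<j. g v k = v k}"

definition depth :: "nat \<Rightarrow> nat \<Rightarrow> ((nat \<Rightarrow> int) \<Rightarrow> (nat \<Rightarrow> int)) set \<Rightarrow> nat" where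
  "depth p n S = Max {i \<in> {0..n}. S \<subseteq> T p n i}"

lemma sigma_in_BijGroup:
  assumes "prime p" and "i < n"
  shows "sigma p n i \<in> carrier (BijGroup (points p n))"
proof -
  have p: "int p > 1" using prime_gt_1_nat[OF assms(1)] by simp
  have fin: "finite (points p n)"
    unfolding points_def by (intro finite_PiE) (auto simp: residue_ring_def)
  have maps: "sigma p n i ` points p n \<subseteq> points p n"
    using p assms(2) by (fastforce simp: sigma_def points_def residue_ring_def PiE_iff extensional_def)
  have inj: "inj_on (sigma p n i) (points p n)"
  proof (rule inj_onI)
    fix v w assume v: "v \<in> points p n" and w: "w \<in> points p n"
      and eq: "sigma p n i v = sigma p n i w"
    have upd: "sigma p n i u k = u k" if "u \<in> points p n" "k \<noteq> i" for u k
      using that by (simp add: sigma_def)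
    have off: "v k = w k" if "k \<noteq> i" for k
      using upd[OF v that] upd[OF w that] eq by simp
    have rng: "0 \<le> v i" "v i < int p" "0 \<le> w i" "w i < int p"
      using v w assms(2) by (auto simp: points_def residue_ring_def PiE_iff)
    have "v i = w i"
    proof (cases "\<forall>k<i. v k = 0")
      case True
      then have "\<forall>k<i. w k = 0" using off by (metis nat_neq_iff)
      with True v w fun_cong[OF eq, of i] have "(v i + 1) mod int p = (w i + 1) mod int p"
        by (simp add: sigma_def residue_ring_def)
      then have "v i mod int p = w i mod int p"
        by (metis add_diff_cancel_right' mod_diff_left_eq)
      with rng show ?thesis by simp
    next
      case False
      then have "\<not> (\<forall>k<i. w k = 0)" using off by (metis nat_neq_iff)
      with False v w fun_cong[OF eq, of i] show ?thesis
        by (auto simp: sigma_def residue_ring_def split: if_splits)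
    qed
    with off show "v = w" by (metis ext)
  qed
  have "bij_betw (sigma p n i) (points p n) (points p n)"
    using endo_inj_surj[OF fin maps inj] inj by (simp add: bij_betw_def)
  then show ?thesis
    by (auto simp: BijGroup_def Bij_def sigma_def)
qed

lemma subgroup_P:
  assumes "prime p"
  shows "subgroup (carrier (P p n)) (BijGroup (points p n))"
  unfolding P_def using assms
  by (auto intro!: group.generate_is_subgroup[OF group_BijGroup] sigma_in_BijGroup)

lemma group_P: "prime p \<Longrightarrow> group (P p n)"
  using group.subgroup_imp_group[OF group_BijGroup subgroup_P]
  by (simp add: P_def)

lemma T_0: "T p n 0 = carrier (P p n)"
  by (simp add: T_def)

text \<open>The maximum defining the depth ranges over a nonempty finite set.\<close>

lemma subset_T_depth:
  assumes "S \<subseteq> carrier (P p n)"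
  shows "depth p n S \<le> n" and "S \<subseteq> T p n (depth p n S)"
proof -
  have "0 \<in> {i \<in> {0..n}. S \<subseteq> T p n i}" using assms by (simp add: T_0)
  then have "depth p n S \<in> {i \<in> {0..n}. S \<subseteq> T p n i}"
    unfolding depth_def by (intro Max_in) auto
  then show "depth p n S \<le> n" and "S \<subseteq> T p n (depth p n S)" by auto
qed

end

(* Let N have depth j < n. By conjugation with the transitive group P_n, N contains for every
   point v an element g of T_j that moves the j-th coordinate of v. Now work modulo N. If x and y
   in T_(j+1) are supported on the cylinder of points that share their first j + 1 coordinates
   with v, then x is congruent to its conjugate by g, whose support is disjoint from that cylinder;
   so x commutes with y. Elements with different supporting cylinders commute anyway, hence
   T_(j+1) is abelian mod N. The restriction h of g to the cylinder of points that share the first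
   j coordinates with v satisfies g = h k, where k commutes with h and with everything supported
   on that cylinder; as g is trivial mod N, h is central in T_j mod N. As p is prime, these h
   together with T_(j+1) generate T_j, so T_j is abelian mod N.

   Restrictions to cylinders stay in P_n because P_n consists of all bijections that act on the
   k-th coordinate by a shift depending only on the previous coordinates. *)

theory Submission
  imports Defs
begin

section \<open>Points with common initial coordinates; evaluation of bijections\<close>

definition agree :: "nat \<Rightarrow> (nat \<Rightarrow> int) \<Rightarrow> (nat \<Rightarrow> int) \<Rightarrow> bool" where
  "agree j v w \<longleftrightarrow> (\<forall>i<j. v i = w i)"

lemma agree_refl [simp]: "agree j v v"
  and agree_sym: "agree j v w \<Longrightarrow> agree j w v"
  and agree_trans: "agree j u v \<Longrightarrow> agree j v w \<Longrightarrow> agree j u w"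
  and agree_mono: "agree j v w \<Longrightarrow> k \<le> j \<Longrightarrow> agree k v w"
  and agree_0 [simp]: "agree 0 v w"
  and agree_Suc: "agree (Suc j) v w \<longleftrightarrow> agree j v w \<and> v j = w j"
  by (auto simp: agree_def less_Suc_eq)

locale prime_power_points =
  fixes p n :: nat
  assumes prime_p: "prime p"
begin

abbreviation X where "X \<equiv> points p n"
abbreviation B where "B \<equiv> BijGroup (points p n)"

sublocale B: group B
  by (rule group_BijGroup)

lemma points_iff: "v \<in> X \<longleftrightarrow> (\<forall>i<n. 0 \<le> v i \<and> v i < int p) \<and> (\<forall>i\<ge>n. v i = undefined)"
  by (auto simp: points_def residue_ring_def PiE_iff extensional_def)

lemma finite_points: "finite X"
  unfolding points_def by (intro finite_PiE) (auto simp: residue_ring_def)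

text \<open>Coordinates below \<open>n\<close> are the representatives 0, ..., p - 1 and all others
  are \<open>undefined\<close>, so a residue determines the coordinate.\<close>

lemma points_cong_iff:
  assumes "v \<in> X" "w \<in> X"
  shows "[v k = w k] (mod int p) \<longleftrightarrow> v k = w k"
proof (cases "k < n")
  case True
  then show ?thesis
    using assms cong_less_imp_eq_int[of "v k" "int p" "w k"] by (auto simp: points_iff)
qed (use assms in \<open>auto simp: points_iff\<close>)

lemma points_eqI:
  assumes "v \<in> X" "w \<in> X" "agree n v w"
  shows "v = w"
  using assms by (intro ext) (metis agree_def linorder_not_less points_iff)

lemma mult_apply:
  assumes "f \<in> carrier B" "g \<in> carrier B" "v \<in> X"
  shows "(f \<otimes>\<^bsub>B\<^esub> g) v = f (g v)"
  using assms by (simp add: BijGroup_def compose_def)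

lemma apply_closed: "f \<in> carrier B \<Longrightarrow> v \<in> X \<Longrightarrow> f v \<in> X"
  by (auto simp: BijGroup_def Bij_def bij_betw_def)

lemma one_apply: "v \<in> X \<Longrightarrow> \<one>\<^bsub>B\<^esub> v = v"
  by (simp add: BijGroup_def)

lemma inv_apply:
  assumes "f \<in> carrier B" "v \<in> X"
  shows "(inv\<^bsub>B\<^esub> f) (f v) = v" and "f ((inv\<^bsub>B\<^esub> f) v) = v"
  using assms mult_apply[of "inv\<^bsub>B\<^esub> f" f v] mult_apply[of f "inv\<^bsub>B\<^esub> f" v]
  by (simp_all add: one_apply)

lemma carrier_eqI:
  assumes "f \<in> carrier B" "g \<in> carrier B" "\<And>v. v \<in> X \<Longrightarrow> f v = g v"
  shows "f = g"
  using assms by (auto simp: BijGroup_def Bij_def intro: extensionalityI)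

section \<open>Triangular bijections\<close>

text \<open>The bijections of the form \<open>v k \<mapsto> v k + f k (v 0, ..., v (k - 1))\<close>.\<close>

definition tri where
  "tri = {g \<in> carrier B. \<forall>v\<in>X. \<forall>w\<in>X. \<forall>k.
     agree k v w \<longrightarrow> [g v k - g w k = v k - w k] (mod int p)}"

lemma tri_carrier: "g \<in> tri \<Longrightarrow> g \<in> carrier B"
  by (simp add: tri_def)

lemma tri_cong:
  "\<lbrakk>g \<in> tri; v \<in> X; w \<in> X; agree k v w\<rbrakk> \<Longrightarrow> [g v k - g w k = v k - w k] (mod int p)"
  by (simp add: tri_def)

text \<open>At two points with the same first \<open>k\<close> coordinates, \<open>g\<close> changes
  coordinate \<open>k\<close> by the same residue.\<close>

lemma tri_eq_iff:
  assumes "g \<in> tri" "v \<in> X" "w \<in> X" "agree k v w"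
  shows "g v k = g w k \<longleftrightarrow> v k = w k"
proof -
  have "[g v k = g w k] (mod int p) \<longleftrightarrow> [v k = w k] (mod int p)"
    using tri_cong[OF assms] by (metis cong_diff_iff_cong_0 cong_sym_eq cong_trans)
  then show ?thesis
    using assms by (simp add: points_cong_iff apply_closed tri_carrier)
qed

text \<open>Prefixes of length \<open>k\<close> are the depth \<open>k\<close> vertices of the
  rooted \<open>p\<close>-ary tree; \<open>tri\<close> acts on it by automorphisms.\<close>

lemma tri_agree_iff:
  assumes "g \<in> tri" "v \<in> X" "w \<in> X"
  shows "agree k (g v) (g w) \<longleftrightarrow> agree k v w"
  by (induction k) (use tri_eq_iff[OF assms] in \<open>auto simp: agree_Suc\<close>)

lemma subgroup_tri: "subgroup tri B"
proof (rule B.subgroupI)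
  show "tri \<subseteq> carrier B" by (auto simp: tri_def)
  have "\<one>\<^bsub>B\<^esub> \<in> tri" by (simp add: tri_def one_apply)
  then show "tri \<noteq> {}" by blast
next
  fix g assume g: "g \<in> tri"
  let ?h = "inv\<^bsub>B\<^esub> g"
  have gB: "g \<in> carrier B" and hB: "?h \<in> carrier B" using g by (auto simp: tri_carrier)
  have "[?h v k - ?h w k = v k - w k] (mod int p)" if "v \<in> X" "w \<in> X" "agree k v w" for v w k
  proof -
    have X: "?h v \<in> X" "?h w \<in> X" using that hB by (simp_all add: apply_closed)
    have "agree k (?h v) (?h w)"
      using tri_agree_iff[OF g X] that inv_apply[OF gB] by simp
    from tri_cong[OF g X this] show ?thesis
      using that inv_apply[OF gB] by (simp add: cong_sym_eq)
  qed
  then show "?h \<in> tri" using hB by (simp add: tri_def)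
next
  fix f g assume fg: "f \<in> tri" "g \<in> tri"
  have B: "f \<in> carrier B" "g \<in> carrier B" using fg by (auto simp: tri_carrier)
  have "[f (g v) k - f (g w) k = v k - w k] (mod int p)" if "v \<in> X" "w \<in> X" "agree k v w" for v w k
    using tri_cong[OF fg(1), of "g v" "g w" k] tri_cong[OF fg(2) that] that
    by (meson B apply_closed cong_trans fg(2) tri_agree_iff)
  then show "f \<otimes>\<^bsub>B\<^esub> g \<in> tri" using B by (simp add: tri_def mult_apply)
qed

lemmas tri_mult = subgroup.m_closed[OF subgroup_tri]
  and tri_inv = subgroup.m_inv_closed[OF subgroup_tri]
  and tri_one = subgroup.one_closed[OF subgroup_tri]

lemma inv_agree_iff:
  assumes "g \<in> tri" "v \<in> X" "w \<in> X"
  shows "agree k ((inv\<^bsub>B\<^esub> g) v) w \<longleftrightarrow> agree k v (g w)"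
  using tri_agree_iff[of g "(inv\<^bsub>B\<^esub> g) v" w k] assms
  by (simp add: inv_apply apply_closed tri_carrier)

section \<open>The level subgroups\<close>

text \<open>This is \<open>T p n j\<close>, as \<open>T_eq_lev\<close> will show. It is defined
  inside \<open>tri\<close> because the identification of \<open>tri\<close> with P_n in
  \<open>carrier_P\<close> is itself an induction over these subgroups.\<close>

definition lev where
  "lev j = {g \<in> tri. \<forall>v\<in>X. agree j (g v) v}"

lemma lev_tri: "g \<in> lev j \<Longrightarrow> g \<in> tri"
  and lev_carrier: "g \<in> lev j \<Longrightarrow> g \<in> carrier B"
  and lev_agree: "g \<in> lev j \<Longrightarrow> v \<in> X \<Longrightarrow> agree j (g v) v"
  by (auto simp: lev_def tri_def)

lemma lev_agree2: "g \<in> lev j \<Longrightarrow> w \<in> X \<Longrightarrow> agree j v (g w) \<longleftrightarrow> agree j v w"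
  by (meson agree_sym agree_trans lev_agree)

lemma lev_0: "lev 0 = tri"
  by (simp add: lev_def)

lemma lev_Suc_subset: "lev (Suc j) \<subseteq> lev j"
  by (auto simp: lev_def agree_Suc)

lemma lev_mult: "f \<in> lev j \<Longrightarrow> g \<in> lev j \<Longrightarrow> f \<otimes>\<^bsub>B\<^esub> g \<in> lev j"
  unfolding lev_def
  by (auto simp: mult_apply tri_carrier tri_mult) (meson agree_trans apply_closed tri_carrier)

lemma lev_inv: "g \<in> lev j \<Longrightarrow> inv\<^bsub>B\<^esub> g \<in> lev j"
  by (auto simp: lev_def tri_inv inv_agree_iff intro: agree_sym)

lemma lev_one: "\<one>\<^bsub>B\<^esub> \<in> lev j"
  by (simp add: lev_def tri_one one_apply)

lemma lev_top:
  assumes "g \<in> lev n"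
  shows "g = \<one>\<^bsub>B\<^esub>"
  using assms
  by (intro carrier_eqI) (auto simp: one_apply lev_carrier lev_agree apply_closed intro!: points_eqI)

section \<open>Elements supported on a cylinder\<close>

text \<open>For a point \<open>v\<close> and j \<le> n this is the direct factor of the base group
  T_j that belongs to the first \<open>j\<close> coordinates of \<open>v\<close>.\<close>

definition cyl where
  "cyl j v = {g \<in> lev j. \<forall>w\<in>X. \<not> agree j v w \<longrightarrow> g w = w}"

lemma cyl_lev: "g \<in> cyl j v \<Longrightarrow> g \<in> lev j"
  and cyl_fix: "\<lbrakk>g \<in> cyl j v; w \<in> X; \<not> agree j v w\<rbrakk> \<Longrightarrow> g w = w"
  by (auto simp: cyl_def)

lemma cyl_carrier: "g \<in> cyl j v \<Longrightarrow> g \<in> carrier B"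
  by (rule lev_carrier[OF cyl_lev])

lemma cyl_cong: "agree j v w \<Longrightarrow> cyl j v = cyl j w"
  unfolding cyl_def by (meson agree_sym agree_trans)

text \<open>Both elements preserve the cylinder and its complement, and on each of these two sets
  one of them is the identity.\<close>

lemma cyl_commute:
  assumes x: "x \<in> cyl j v" and y: "y \<in> lev j"
    and triv: "\<And>w. w \<in> X \<Longrightarrow> agree j v w \<Longrightarrow> y w = w"
  shows "x \<otimes>\<^bsub>B\<^esub> y = y \<otimes>\<^bsub>B\<^esub> x"
proof -
  have B: "x \<in> carrier B" "y \<in> carrier B" using x y by (auto dest: cyl_lev lev_carrier)
  have "x (y w) = y (x w)" if w: "w \<in> X" for w
  proof (cases "agree j v w")
    case True
    then show ?thesis
      using triv[OF w] triv[OF apply_closed[OF B(1) w]] lev_agree2[OF cyl_lev[OF x] w] by simp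
  next
    case False
    then show ?thesis
      using cyl_fix[OF x w] cyl_fix[OF x apply_closed[OF B(2) w]] lev_agree2[OF y w] by simp
  qed
  then show ?thesis using B by (intro carrier_eqI) (auto simp: mult_apply)
qed

lemma cyl_commute_disjoint:
  assumes "x \<in> cyl j v" "y \<in> cyl j w" "\<not> agree j v w"
  shows "x \<otimes>\<^bsub>B\<^esub> y = y \<otimes>\<^bsub>B\<^esub> x"
proof (rule cyl_commute[OF assms(1) cyl_lev[OF assms(2)]])
  fix u assume "u \<in> X" "agree j v u"
  then show "y u = u" using assms(2,3) by (meson agree_sym agree_trans cyl_fix)
qed

section \<open>Conjugation by triangular bijections\<close>

lemma conj_apply:
  assumes "u \<in> carrier B" "g \<in> carrier B" "v \<in> X"
  shows "(u \<otimes>\<^bsub>B\<^esub> g \<otimes>\<^bsub>B\<^esub> inv\<^bsub>B\<^esub> u) v = u (g ((inv\<^bsub>B\<^esub> u) v))"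
  using assms by (simp add: mult_apply apply_closed)

lemma conj_lev:
  assumes "u \<in> tri" "g \<in> lev j"
  shows "u \<otimes>\<^bsub>B\<^esub> g \<otimes>\<^bsub>B\<^esub> inv\<^bsub>B\<^esub> u \<in> lev j"
proof -
  have B: "u \<in> carrier B" "g \<in> carrier B" using assms by (auto dest: tri_carrier lev_carrier)
  have "agree j (u (g ((inv\<^bsub>B\<^esub> u) v))) v" if "v \<in> X" for v
  proof -
    have "agree j (g ((inv\<^bsub>B\<^esub> u) v)) ((inv\<^bsub>B\<^esub> u) v)"
      using B that by (intro lev_agree[OF assms(2)]) (simp add: apply_closed)
    then have "agree j (u (g ((inv\<^bsub>B\<^esub> u) v))) (u ((inv\<^bsub>B\<^esub> u) v))"
      using B that by (subst tri_agree_iff[OF assms(1)]) (simp_all add: apply_closed)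
    then show ?thesis using B that by (simp add: inv_apply)
  qed
  then show ?thesis
    using assms B by (auto simp: lev_def conj_apply intro!: tri_mult tri_inv)
qed

lemma conj_cyl:
  assumes "u \<in> tri" "g \<in> cyl j v" "v \<in> X"
  shows "u \<otimes>\<^bsub>B\<^esub> g \<otimes>\<^bsub>B\<^esub> inv\<^bsub>B\<^esub> u \<in> cyl j (u v)"
proof -
  have B: "u \<in> carrier B" "g \<in> carrier B"
    using assms by (auto dest: tri_carrier cyl_lev lev_carrier)
  have "u (g ((inv\<^bsub>B\<^esub> u) w)) = w" if "w \<in> X" "\<not> agree j (u v) w" for w
  proof -
    have "\<not> agree j v ((inv\<^bsub>B\<^esub> u) w)"
      using inv_agree_iff[OF assms(1) that(1) assms(3), of j] that agree_sym by blast
    then show ?thesis using cyl_fix[OF assms(2)] B that by (simp add: inv_apply apply_closed)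
  qed
  then show ?thesis
    using assms B by (auto simp: cyl_def conj_apply intro!: conj_lev)
qed

section \<open>Restriction to cylinders and generation of the level subgroups\<close>

text \<open>Cutting \<open>g\<close> off outside the cylinder respects the congruences of
  \<open>tri\<close>: coordinates below \<open>j\<close> do not change at all, and for k \<ge> j two
  points sharing \<open>k\<close> coordinates lie both inside or both outside the cylinder.\<close>

lemma restrict_cylinder:
  assumes g: "g \<in> lev j"
  obtains h where "h \<in> cyl j v" "\<And>w. w \<in> X \<Longrightarrow> agree j v w \<Longrightarrow> h w = g w"
proof -
  define h where "h = (\<lambda>w\<in>X. if agree j v w then g w else w)"
  have gB: "g \<in> carrier B" using g by (rule lev_carrier)
  have inX: "h w \<in> X" if "w \<in> X" for w using that gB by (simp add: h_def apply_closed)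
  have ag: "agree j (h w) w" if "w \<in> X" for w using that g by (simp add: h_def lev_agree)
  have inj: "inj_on h X"
  proof (rule inj_onI)
    fix a b assume ab: "a \<in> X" "b \<in> X" "h a = h b"
    then have "agree j a b" using ag by (metis agree_sym agree_trans)
    then have "agree j v a \<longleftrightarrow> agree j v b" by (meson agree_sym agree_trans)
    then have "a = b \<or> g a = g b" using ab by (auto simp: h_def split: if_splits)
    then show "a = b" using inv_apply(1)[OF gB ab(1)] inv_apply(1)[OF gB ab(2)] by metis
  qed
  have "h ` X = X" using inX inj finite_points by (intro endo_inj_surj) auto
  with inj have hB: "h \<in> carrier B" by (simp add: BijGroup_def Bij_def bij_betw_def h_def)
  have "[h a k - h b k = a k - b k] (mod int p)" if ab: "a \<in> X" "b \<in> X" "agree k a b" for a b k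
  proof (cases "k < j")
    case True
    then show ?thesis using ag ab by (simp add: agree_def)
  next
    case False
    then have "agree j a b" using ab by (auto intro: agree_mono)
    then have "agree j v a \<longleftrightarrow> agree j v b" by (meson agree_sym agree_trans)
    then show ?thesis using ab tri_cong[OF lev_tri[OF g] ab] by (simp add: h_def)
  qed
  then have "h \<in> cyl j v" using hB ag by (auto simp: cyl_def lev_def tri_def h_def)
  then show ?thesis by (rule that) (simp add: h_def)
qed

lemma split_cylinder:
  assumes g: "g \<in> lev j"
  obtains h k where "h \<in> cyl j v" "k \<in> lev j" "g = h \<otimes>\<^bsub>B\<^esub> k"
    "\<And>w. w \<in> X \<Longrightarrow> agree j v w \<Longrightarrow> h w = g w"
    "\<And>w. w \<in> X \<Longrightarrow> agree j v w \<Longrightarrow> k w = w"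
    "\<And>w. w \<in> X \<Longrightarrow> \<not> agree j v w \<Longrightarrow> k w = g w"
proof -
  obtain h where h: "h \<in> cyl j v" "\<And>w. w \<in> X \<Longrightarrow> agree j v w \<Longrightarrow> h w = g w"
    using restrict_cylinder[OF g] by blast
  have B: "g \<in> carrier B" "h \<in> carrier B"
    using g h by (auto dest: cyl_lev lev_carrier)
  \<comment> \<open>On the cylinder \<open>h\<close> coincides with \<open>g\<close> and is
    cancelled; off it \<open>h\<close> fixes \<open>g w\<close>, since \<open>g\<close> keeps
    \<open>w\<close> outside the cylinder.\<close>
  let ?k = "inv\<^bsub>B\<^esub> h \<otimes>\<^bsub>B\<^esub> g"
  have eq: "?k w = (inv\<^bsub>B\<^esub> h) (g w)" if "w \<in> X" for w using B that by (simp add: mult_apply)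
  show ?thesis
  proof (rule that[of h ?k])
    show "?k \<in> lev j" using g h by (intro lev_mult lev_inv) (auto dest: cyl_lev)
    show "g = h \<otimes>\<^bsub>B\<^esub> ?k" using B by (simp add: B.m_assoc[symmetric])
    show "?k w = w" if "w \<in> X" "agree j v w" for w
      using eq[OF that(1)] h(2)[OF that] inv_apply(1)[OF B(2) that(1)] by simp
    show "?k w = g w" if "w \<in> X" "\<not> agree j v w" for w
    proof -
      have "h (g w) = g w"
        using that B lev_agree2[OF g that(1)] by (intro cyl_fix[OF h(1)]) (auto simp: apply_closed)
      then show ?thesis
        using eq[OF that(1)] inv_apply(1)[OF B(2) apply_closed[OF B(1) that(1)]] by simp
    qed
  qed (use h in auto)
qed

text \<open>The cylinder factors generate T_j: splitting off the factor at a moved point leaves an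
  element that moves fewer points. \<open>K\<close> is a set closed under products, so that
  centralizers modulo a kernel can be inserted later.\<close>

lemma lev_subset_if_cyl_subset:
  assumes one: "\<one>\<^bsub>B\<^esub> \<in> K" and mult: "\<And>x y. \<lbrakk>x \<in> K; y \<in> K\<rbrakk> \<Longrightarrow> x \<otimes>\<^bsub>B\<^esub> y \<in> K"
    and cyl: "\<And>v. v \<in> X \<Longrightarrow> cyl j v \<subseteq> K"
  shows "lev j \<subseteq> K"
proof
  fix g assume "g \<in> lev j"
  then show "g \<in> K"
  proof (induction "card {w \<in> X. g w \<noteq> w}" arbitrary: g rule: less_induct)
    case less
    show ?case
    proof (cases "\<exists>v\<in>X. g v \<noteq> v")
      case False
      then have "g = \<one>\<^bsub>B\<^esub>" using less.prems by (intro carrier_eqI) (auto simp: one_apply lev_carrier)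
      then show ?thesis using one by simp
    next
      case True
      then obtain v where v: "v \<in> X" "g v \<noteq> v" by blast
      obtain h k where hk: "h \<in> cyl j v" "k \<in> lev j" "g = h \<otimes>\<^bsub>B\<^esub> k"
        "\<And>w. w \<in> X \<Longrightarrow> agree j v w \<Longrightarrow> k w = w"
        "\<And>w. w \<in> X \<Longrightarrow> \<not> agree j v w \<Longrightarrow> k w = g w"
        using split_cylinder[OF less.prems] by metis
      have "{w \<in> X. k w \<noteq> w} \<subset> {w \<in> X. g w \<noteq> w}"
      proof
        show "{w \<in> X. k w \<noteq> w} \<subseteq> {w \<in> X. g w \<noteq> w}" using hk(4,5) by force
        show "{w \<in> X. k w \<noteq> w} \<noteq> {w \<in> X. g w \<noteq> w}" using v hk(4)[of v] by auto
      qed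
      then have "k \<in> K"
        using hk(2) finite_points by (intro less.hyps psubset_card_mono) auto
      then show ?thesis using hk(1,3) cyl[OF v(1)] mult by auto
    qed
  qed
qed

text \<open>The shift of coordinate \<open>j\<close> is constant on the cylinder, so it vanishes
  there once it vanishes at \<open>v\<close>.\<close>

lemma lev_SucI:
  assumes "g \<in> cyl j v" "v \<in> X" "g v j = v j"
  shows "g \<in> lev (Suc j)"
proof -
  have "g w j = w j" if w: "w \<in> X" for w
  proof (cases "agree j v w")
    case True
    have "[g v j - g w j = v j - w j] (mod int p)"
      using tri_cong[OF _ assms(2) w True] assms(1) by (auto dest: cyl_lev lev_tri)
    then have "[g w j = w j] (mod int p)"
      using assms(3) by (simp add: cong_diff_iff_cong_0 cong_iff_dvd_diff algebra_simps dvd_diff_commute)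
    then show ?thesis
      by (simp add: points_cong_iff[OF apply_closed[OF cyl_carrier[OF assms(1)] w] w])
  qed (use assms w cyl_fix in simp)
  then show ?thesis using assms by (auto simp: lev_def agree_Suc dest: cyl_lev)
qed

lemma cyl_inv: "g \<in> cyl j v \<Longrightarrow> inv\<^bsub>B\<^esub> g \<in> cyl j v"
  unfolding cyl_def by (auto intro: lev_inv) (metis inv_apply(1) lev_carrier)

lemma cyl_mult: "f \<in> cyl j v \<Longrightarrow> g \<in> cyl j v \<Longrightarrow> f \<otimes>\<^bsub>B\<^esub> g \<in> cyl j v"
  unfolding cyl_def by (auto simp: mult_apply lev_carrier intro: lev_mult)

text \<open>On \<open>cyl j v\<close> the shift of coordinate \<open>j\<close> at \<open>v\<close>
  is additive modulo \<open>p\<close>, and elements of shift zero lie in \<open>lev (Suc j)\<close>.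
  As \<open>p\<close> is prime, the multiples of one nonzero shift exhaust all residues.\<close>

lemma lev_subset_if_Suc_subset:
  assumes mult: "\<And>x y. \<lbrakk>x \<in> K; y \<in> K\<rbrakk> \<Longrightarrow> x \<otimes>\<^bsub>B\<^esub> y \<in> K"
    and Suc: "lev (Suc j) \<subseteq> K"
    and shift: "\<And>v. v \<in> X \<Longrightarrow> \<exists>h \<in> cyl j v \<inter> K. h v j \<noteq> v j"
  shows "lev j \<subseteq> K"
proof (rule lev_subset_if_cyl_subset[OF _ mult])
  show "\<one>\<^bsub>B\<^esub> \<in> K" using Suc lev_one by blast
next
  fix v assume v: "v \<in> X"
  then obtain h where h: "h \<in> cyl j v" "h \<in> K" "h v j \<noteq> v j" using shift by blast
  have hT: "h \<in> tri" and hB: "h \<in> carrier B" using h by (auto dest: cyl_lev lev_tri lev_carrier)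
  define d where "d = h v j - v j"
  have "\<not> [d = 0] (mod int p)"
    using h(3) points_cong_iff[OF apply_closed[OF hB v] v]
    by (simp add: d_def cong_diff_iff_cong_0)
  then have "coprime d (int p)"
    using prime_p by (metis cong_0_iff coprime_commute prime_imp_coprime prime_nat_int_transfer)
  then obtain e where e: "[d * e = 1] (mod int p)" using cong_solve_coprime_int by blast
  \<comment> \<open>Induction on the number of factors \<open>h\<close> to be peeled off; each
    lowers the shift by \<open>d\<close>, and shift zero is covered by
    \<open>lev (Suc j)\<close>.\<close>
  have shift_K: "g \<in> K" if "g \<in> cyl j v" "[g v j = v j + int m * d] (mod int p)" for g m
    using that
  proof (induction m arbitrary: g)
    case 0
    then have "g v j = v j"
      using points_cong_iff[OF apply_closed[OF cyl_carrier[OF 0(1)] v] v] by simp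
    then show ?case using lev_SucI[OF 0(1) v] Suc by blast
  next
    case (Suc m)
    have gB: "g \<in> carrier B" using Suc.prems by (auto dest: cyl_lev lev_carrier)
    let ?k = "inv\<^bsub>B\<^esub> h \<otimes>\<^bsub>B\<^esub> g"
    have k: "?k \<in> cyl j v" using h Suc.prems by (intro cyl_mult cyl_inv)
    have kB: "?k \<in> carrier B" using gB hB by simp
    have g: "g = h \<otimes>\<^bsub>B\<^esub> ?k" using gB hB by (simp add: B.m_assoc[symmetric])
    have "g v = h (?k v)" by (subst g) (use gB hB kB v in \<open>simp add: mult_apply\<close>)
    \<comment> \<open>\<open>?k v\<close> and \<open>v\<close> share their first \<open>j\<close>
      coordinates, so \<open>h\<close> shifts coordinate \<open>j\<close> equally at both.\<close>
    moreover have "[h (?k v) j - h v j = ?k v j - v j] (mod int p)"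
      using tri_cong[OF hT apply_closed[OF kB v] v] lev_agree[OF cyl_lev[OF k] v] by blast
    ultimately have "[?k v j - v j = g v j - h v j] (mod int p)" by (simp add: cong_sym_eq)
    also have "[g v j - h v j = (v j + int (Suc m) * d) - h v j] (mod int p)"
      using Suc.prems(2) by (intro cong_diff) auto
    also have "(v j + int (Suc m) * d) - h v j = int m * d" by (simp add: d_def algebra_simps)
    finally have "[?k v j - v j + v j = int m * d + v j] (mod int p)" by (intro cong_add) auto
    then have "[?k v j = v j + int m * d] (mod int p)" by (simp add: algebra_simps)
    with Suc.IH[OF k] have "?k \<in> K" .
    then have "h \<otimes>\<^bsub>B\<^esub> ?k \<in> K" using h mult by blast
    then show ?case using g by simp
  qed
  show "cyl j v \<subseteq> K"
  proof
    fix g assume g: "g \<in> cyl j v"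
    define c where "c = g v j - v j"
    \<comment> \<open>As \<open>e\<close> inverts \<open>d\<close> modulo \<open>p\<close>, this is
      the solution of m * d = c. A natural number is chosen because \<open>K\<close> is only known
      to be closed under products.\<close>
    define m where "m = nat (c * e mod int p)"
    have p0: "int p > 0" using prime_p by (simp add: prime_gt_0_nat)
    have "int m = c * e mod int p" using p0 by (simp add: m_def)
    then have "[int m * d = c * e * d] (mod int p)"
      by (simp add: cong_def mod_mult_left_eq)
    also have "c * e * d = c * (d * e)" by simp
    also have "[c * (d * e) = c * 1] (mod int p)" using e by (rule cong_scalar_left)
    finally have "[int m * d + v j = c * 1 + v j] (mod int p)" by (intro cong_add) auto
    then have "[g v j = v j + int m * d] (mod int p)"
      by (simp add: c_def cong_sym_eq algebra_simps)
    with g show "g \<in> K" by (rule shift_K)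
  qed
qed

section \<open>The generators, transitivity, and P_n as the group of triangular bijections\<close>

lemma sigma_apply:
  "v \<in> X \<Longrightarrow> sigma p n i v = (if \<forall>k<i. v k = 0 then v(i := (v i + 1) mod int p) else v)"
  by (auto simp: sigma_def residue_ring_def)

lemma sigma_tri:
  assumes "i < n"
  shows "sigma p n i \<in> tri"
proof -
  have "[sigma p n i v k - sigma p n i w k = v k - w k] (mod int p)"
    if "v \<in> X" "w \<in> X" "agree k v w" for v w k
  proof (cases "k = i")
    case True
    then have "(\<forall>l<i. v l = 0) \<longleftrightarrow> (\<forall>l<i. w l = 0)" using that by (auto simp: agree_def)
    moreover have "[(v i + 1) mod int p - (w i + 1) mod int p = v i - w i] (mod int p)"
      by (simp add: cong_def mod_diff_eq)
    ultimately show ?thesis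
      using that True by (auto simp: sigma_apply)
  qed (use that in \<open>simp add: sigma_apply\<close>)
  then show ?thesis using sigma_in_BijGroup[OF prime_p assms] by (simp add: tri_def)
qed

lemma sigma_cyl:
  assumes "i < n" "\<forall>k<i. v k = 0"
  shows "sigma p n i \<in> cyl i v"
  using assms sigma_tri[OF assms(1)] by (auto simp: cyl_def lev_def agree_def sigma_apply)

abbreviation G where "G \<equiv> carrier (P p n)"

lemma subgroup_G: "subgroup G B"
  by (rule subgroup_P[OF prime_p])

lemmas G_mult = subgroup.m_closed[OF subgroup_G]
  and G_inv = subgroup.m_inv_closed[OF subgroup_G]
  and G_one = subgroup.one_closed[OF subgroup_G]
  and G_carrier = subgroup.mem_carrier[OF subgroup_G]

lemma sigma_G: "i < n \<Longrightarrow> sigma p n i \<in> G"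
  by (auto simp: P_def intro: generate.incl)

text \<open>Coordinates are cleared from left to right: once those before \<open>j\<close> are zero,
  \<open>sigma p n j\<close> adds 1 to coordinate \<open>j\<close> and leaves the cleared ones
  alone.\<close>

lemma move_to_0:
  assumes v: "v \<in> X" and "j \<le> n"
  shows "\<exists>u\<in>G. \<forall>k<j. u v k = 0"
  using \<open>j \<le> n\<close>
proof (induction j)
  case 0
  then show ?case using G_one by auto
next
  case (Suc j)
  have p0: "int p > 0" using prime_p by (simp add: prime_gt_0_nat)
  obtain u where u: "u \<in> G" "\<forall>k<j. u v k = 0" using Suc by auto
  \<comment> \<open>\<open>m\<close> counts applications of \<open>sigma p n j\<close>; the name
    \<open>w\<close> freezes the starting point \<open>u v\<close> while the group element
    varies.\<close>
  have "\<exists>u\<in>G. (\<forall>k<j. u v k = 0) \<and> u v j = (w j + int m) mod int p" if w: "w = u v" for w m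
  proof (induction m)
    case 0
    have "w \<in> X" using u v w by (simp add: apply_closed G_carrier)
    then show ?case using u w Suc.prems by (auto simp: points_iff intro!: bexI[of _ u])
  next
    case (Suc m)
    then obtain u' where u': "u' \<in> G" "\<forall>k<j. u' v k = 0" "u' v j = (w j + int m) mod int p" by blast
    have j: "j < n" using \<open>Suc j \<le> n\<close> by simp
    have "(sigma p n j \<otimes>\<^bsub>B\<^esub> u') v = sigma p n j (u' v)"
      using u' v j by (simp add: mult_apply G_carrier sigma_G)
    also have "\<dots> = (u' v)(j := (u' v j + 1) mod int p)"
      using u' v by (simp add: sigma_apply apply_closed G_carrier)
    finally show ?case
      using u' j by (intro bexI[of _ "sigma p n j \<otimes>\<^bsub>B\<^esub> u'"])
        (auto intro: G_mult sigma_G simp: mod_simps algebra_simps)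
  qed
  from this[OF refl, of "nat (- u v j mod int p)"] obtain u' where
    "u' \<in> G" "\<forall>k<j. u' v k = 0" "u' v j = (u v j + (- u v j mod int p)) mod int p"
    using p0 by auto
  then show ?case by (intro bexI[of _ u']) (auto simp: less_Suc_eq mod_simps)
qed

text \<open>Both points can be moved to the zero vector; one move followed by the inverse of the
  other joins them.\<close>

lemma transitive:
  assumes "v \<in> X" "w \<in> X"
  obtains u where "u \<in> G" "u v = w"
proof -
  obtain a where a: "a \<in> G" "\<forall>k<n. a v k = 0" using move_to_0[OF assms(1)] by blast
  obtain b where b: "b \<in> G" "\<forall>k<n. b w k = 0" using move_to_0[OF assms(2)] by blast
  have eq: "a v = b w"
    using a b assms by (intro points_eqI) (auto simp: agree_def apply_closed G_carrier)
  show ?thesis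
  proof (rule that)
    show "inv\<^bsub>B\<^esub> b \<otimes>\<^bsub>B\<^esub> a \<in> G" using a b by (intro G_mult G_inv)
    show "(inv\<^bsub>B\<^esub> b \<otimes>\<^bsub>B\<^esub> a) v = w"
      using a b assms eq by (simp add: mult_apply G_carrier inv_apply)
  qed
qed

text \<open>\<open>g v\<close> and \<open>v\<close> share their first \<open>j\<close> coordinates,
  so \<open>u\<close> cannot make their different \<open>j\<close>-th coordinates equal.\<close>

lemma conj_moves:
  assumes "u \<in> tri" "g \<in> lev j" "v \<in> X" "g v j \<noteq> v j"
  shows "(u \<otimes>\<^bsub>B\<^esub> g \<otimes>\<^bsub>B\<^esub> inv\<^bsub>B\<^esub> u) (u v) j \<noteq> u v j"
proof -
  have B: "u \<in> carrier B" "g \<in> carrier B" using assms by (auto dest: tri_carrier lev_carrier)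
  have "(u \<otimes>\<^bsub>B\<^esub> g \<otimes>\<^bsub>B\<^esub> inv\<^bsub>B\<^esub> u) (u v) = u (g v)"
    using B assms by (simp add: conj_apply apply_closed inv_apply)
  then show ?thesis
    using tri_eq_iff[OF assms(1) apply_closed[OF B(2) assms(3)] assms(3) lev_agree[OF assms(2,3)]]
      assms(4) by simp
qed

text \<open>Downward induction from the trivial group \<open>lev n\<close>: conjugates of
  \<open>sigma p n j\<close> under the transitive group provide a nonzero shift of coordinate
  \<open>j\<close> in every cylinder.\<close>

lemma carrier_P: "G = tri"
proof
  show sub: "G \<subseteq> tri"
    using B.generate_subgroup_incl[OF _ subgroup_tri, of "sigma p n ` {..<n}"] sigma_tri
    by (auto simp: P_def)
  have "lev j \<subseteq> G" if "j \<le> n" for j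
    using that
  proof (induction rule: inc_induct)
    case base
    then show ?case using lev_top G_one by blast
  next
    case (step j)
    show ?case
    proof (rule lev_subset_if_Suc_subset[OF G_mult step.IH])
      fix v assume v: "v \<in> X"
      \<comment> \<open>The zero vector, extended by \<open>undefined\<close> so that it is a point;
        \<open>sigma p n j\<close> moves its coordinate \<open>j\<close>.\<close>
      define z :: "nat \<Rightarrow> int" where "z = (\<lambda>k. if k < n then 0 else undefined)"
      have p1: "int p > 1" using prime_gt_1_nat[OF prime_p] by simp
      have z: "z \<in> X" using p1 by (simp add: z_def points_iff)
      obtain u where u: "u \<in> G" "u z = v" using transitive[OF z v] by blast
      have z0: "\<forall>k<j. z k = 0" using step by (simp add: z_def)
      have s: "sigma p n j \<in> cyl j z" using step z0 by (intro sigma_cyl)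
      have "sigma p n j z j \<noteq> z j" using z z0 step p1 by (simp add: sigma_apply z_def)
      from conj_moves[OF _ cyl_lev[OF s] z this] conj_cyl[OF _ s z] u sub
      show "\<exists>h\<in>cyl j v \<inter> G. h v j \<noteq> v j"
        using step by (intro bexI[of _ "u \<otimes>\<^bsub>B\<^esub> sigma p n j \<otimes>\<^bsub>B\<^esub> inv\<^bsub>B\<^esub> u"])
          (auto intro!: G_mult G_inv sigma_G)
    qed
  qed
  from this[of 0] show "tri \<subseteq> G" by (simp add: lev_0)
qed

lemma T_eq_lev: "T p n j = lev j"
  by (simp add: T_def lev_def carrier_P agree_def)

lemma P_simps: "x \<otimes>\<^bsub>P p n\<^esub> y = x \<otimes>\<^bsub>B\<^esub> y" "\<one>\<^bsub>P p n\<^esub> = \<one>\<^bsub>B\<^esub>"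
  by (simp_all add: P_def)

section \<open>Commutation modulo a kernel\<close>

text \<open>\<open>\<phi>\<close> will be the projection modulo N. The assumption \<open>ker\<close>
  records what normality, transitivity and the depth of N provide.\<close>

lemma lev_commute_mod:
  assumes hom: "group_hom (P p n) Q \<phi>"
    and ker: "\<And>v. v \<in> X \<Longrightarrow> \<exists>g\<in>lev j. \<phi> g = \<one>\<^bsub>Q\<^esub> \<and> g v j \<noteq> v j"
    and "x \<in> lev j" "y \<in> lev j"
  shows "\<phi> x \<otimes>\<^bsub>Q\<^esub> \<phi> y = \<phi> y \<otimes>\<^bsub>Q\<^esub> \<phi> x"
proof -
  interpret \<phi>: group_hom "P p n" Q \<phi> by (rule hom)
  have closed: "\<phi> a \<in> carrier Q" if "a \<in> tri" for a using that carrier_P by auto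
  have mult: "\<phi> (a \<otimes>\<^bsub>B\<^esub> b) = \<phi> a \<otimes>\<^bsub>Q\<^esub> \<phi> b" if "a \<in> tri" "b \<in> tri" for a b
    using that \<phi>.hom_mult[of a b] by (simp add: carrier_P P_simps)
  \<comment> \<open>The preimage of the centralizer of \<open>\<phi> y\<close>. It is closed under
    products, so both generation lemmas apply with K = \<open>C y\<close>.\<close>
  define C where "C y = {x \<in> tri. \<phi> x \<otimes>\<^bsub>Q\<^esub> \<phi> y = \<phi> y \<otimes>\<^bsub>Q\<^esub> \<phi> x}" for y
  have C_mult: "a \<otimes>\<^bsub>B\<^esub> b \<in> C y" if "y \<in> tri" "a \<in> C y" "b \<in> C y" for a b y
  proof -
    have "\<phi> a \<otimes>\<^bsub>Q\<^esub> \<phi> b \<otimes>\<^bsub>Q\<^esub> \<phi> y = \<phi> y \<otimes>\<^bsub>Q\<^esub> (\<phi> a \<otimes>\<^bsub>Q\<^esub> \<phi> b)"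
      using that closed[of a] closed[of b] closed[of y]
      by (simp add: C_def \<phi>.H.m_assoc) (simp add: \<phi>.H.m_assoc[symmetric])
    then show ?thesis using that by (simp add: C_def mult tri_mult)
  qed
  have C_one: "\<one>\<^bsub>B\<^esub> \<in> C y" if "y \<in> tri" for y
    using that \<phi>.hom_one closed by (simp add: C_def P_simps tri_one)
  have C_sym: "a \<in> C b \<longleftrightarrow> b \<in> C a" if "a \<in> tri" "b \<in> tri" for a b
    using that by (auto simp: C_def)
  have C_comm: "a \<in> C b" if "a \<in> tri" "b \<in> tri" "a \<otimes>\<^bsub>B\<^esub> b = b \<otimes>\<^bsub>B\<^esub> a" for a b
    using that mult[of a b] mult[of b a] by (simp add: C_def)
  have cyl_tri: "a \<in> tri" if "a \<in> cyl i v" for a i v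
    using that by (auto dest: cyl_lev lev_tri)

  have same_cyl: "a \<in> C b" if v: "v \<in> X" and a: "a \<in> cyl (Suc j) v" and b: "b \<in> cyl (Suc j) v" for a b v
  proof -
    obtain g where g: "g \<in> lev j" "\<phi> g = \<one>\<^bsub>Q\<^esub>" "g v j \<noteq> v j" using ker[OF v] by blast
    note T = lev_tri[OF g(1)] cyl_tri[OF a] cyl_tri[OF b]
    let ?a = "g \<otimes>\<^bsub>B\<^esub> a \<otimes>\<^bsub>B\<^esub> inv\<^bsub>B\<^esub> g"
    \<comment> \<open>\<open>g v\<close> and \<open>v\<close> differ in coordinate \<open>j\<close>,
      so the conjugate lives on a cylinder of level j + 1 disjoint from that of
      \<open>b\<close>.\<close>
    have a': "?a \<in> cyl (Suc j) (g v)" using T a v by (intro conj_cyl)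
    have "?a \<otimes>\<^bsub>B\<^esub> g = g \<otimes>\<^bsub>B\<^esub> a" using T by (simp add: B.m_assoc tri_carrier)
    then have "\<phi> ?a \<otimes>\<^bsub>Q\<^esub> \<phi> g = \<phi> g \<otimes>\<^bsub>Q\<^esub> \<phi> a"
      using T mult cyl_tri[OF a'] by metis
    then have eq: "\<phi> ?a = \<phi> a" using g(2) closed T cyl_tri[OF a'] by simp
    have "?a \<in> C b"
      using cyl_commute_disjoint[OF a' b] g(3) T cyl_tri[OF a'] by (intro C_comm) (auto simp: agree_Suc)
    then show ?thesis using eq T by (simp add: C_def)
  qed
  have cyl_C: "cyl i v \<subseteq> C b" if "b \<in> cyl i w" "\<not> agree i v w" for b i v w
    using that cyl_commute_disjoint[of _ i v b w] by (auto intro!: C_comm cyl_tri)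
  \<comment> \<open>The second element still lies in a single cylinder factor; the symmetry of
    \<open>C\<close> then removes this restriction in \<open>lev_Suc_C\<close>.\<close>
  have lev_C_cyl: "lev (Suc j) \<subseteq> C b" if w: "w \<in> X" and b: "b \<in> cyl (Suc j) w" for b w
  proof (rule lev_subset_if_cyl_subset)
    fix v assume v: "v \<in> X"
    show "cyl (Suc j) v \<subseteq> C b"
    proof (cases "agree (Suc j) v w")
      case True
      then show ?thesis using same_cyl[OF w _ b] cyl_cong by blast
    qed (rule cyl_C[OF b])
  qed (use b in \<open>auto intro: C_one C_mult cyl_tri\<close>)
  have lev_Suc_C: "lev (Suc j) \<subseteq> C a" if a: "a \<in> lev (Suc j)" for a
  proof (rule lev_subset_if_cyl_subset)
    fix v assume v: "v \<in> X"
    show "cyl (Suc j) v \<subseteq> C a"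
      using lev_C_cyl[OF v] a C_sym cyl_tri lev_tri by blast
  qed (use a in \<open>auto intro: C_one C_mult lev_tri\<close>)

  have shift: "\<exists>h \<in> cyl j v. h v j \<noteq> v j \<and> (\<forall>b \<in> lev j. h \<in> C b)" if v: "v \<in> X" for v
  proof -
    obtain g where g: "g \<in> lev j" "\<phi> g = \<one>\<^bsub>Q\<^esub>" "g v j \<noteq> v j" using ker[OF v] by blast
    obtain h k where hk: "h \<in> cyl j v" "k \<in> lev j" "g = h \<otimes>\<^bsub>B\<^esub> k"
      "\<And>w. w \<in> X \<Longrightarrow> agree j v w \<Longrightarrow> h w = g w"
      "\<And>w. w \<in> X \<Longrightarrow> agree j v w \<Longrightarrow> k w = w"
      using split_cylinder[OF g(1), of v] by metis
    have hT: "h \<in> tri" and kT: "k \<in> tri" using hk by (auto intro: cyl_tri lev_tri)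
    have hk1: "\<phi> h \<otimes>\<^bsub>Q\<^esub> \<phi> k = \<one>\<^bsub>Q\<^esub>" using mult[OF hT kT] g(2) hk(3) by simp
    \<comment> \<open>\<open>\<phi> h\<close> and \<open>\<phi> k\<close> are mutually inverse, so
      what commutes with one commutes with the other; and \<open>k\<close> fixes the cylinder
      pointwise, hence commutes with \<open>b\<close>.\<close>
    have same: "h \<in> C b" if b: "b \<in> cyl j v" for b
    proof -
      have bT: "b \<in> tri" using b by (rule cyl_tri)
      have "\<phi> b \<otimes>\<^bsub>Q\<^esub> \<phi> k = \<phi> k \<otimes>\<^bsub>Q\<^esub> \<phi> b"
        using cyl_commute[OF b hk(2)] hk(5) mult bT kT by metis
      moreover have "\<phi> k = inv\<^bsub>Q\<^esub> \<phi> h"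
        using hk1 hT kT closed by (metis \<phi>.H.inv_equality \<phi>.H.inv_comm)
      ultimately show ?thesis
        using hT bT closed
        by (simp add: C_def) (metis \<phi>.H.inv_closed \<phi>.H.inv_solve_left' \<phi>.H.inv_solve_right' \<phi>.H.m_assoc \<phi>.H.m_closed)
    qed
    have "lev j \<subseteq> C h"
    proof (rule lev_subset_if_cyl_subset)
      fix w assume w: "w \<in> X"
      show "cyl j w \<subseteq> C h"
      proof (cases "agree j w v")
        case True
        then show ?thesis using same C_sym hT cyl_tri cyl_cong by blast
      qed (rule cyl_C[OF hk(1)])
    qed (use hT in \<open>auto intro: C_one C_mult\<close>)
    then show ?thesis
      using hk(1) hk(4)[OF v] g(3) C_sym hT lev_tri by (intro bexI[of _ h]) auto
  qed
  have lev_C: "lev j \<subseteq> C b" if b: "b \<in> lev j" and sub: "lev (Suc j) \<subseteq> C b" for b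
  proof (rule lev_subset_if_Suc_subset[OF C_mult[OF lev_tri[OF b]] sub])
    show "\<exists>h\<in>cyl j v \<inter> C b. h v j \<noteq> v j" if "v \<in> X" for v
      using shift[OF that] b by blast
  qed
  \<comment> \<open>\<open>lev_C\<close> is used twice: first for \<open>a\<close> in
    \<open>lev (Suc j)\<close>, where \<open>lev_Suc_C\<close> supplies its premise, and then, by
    symmetry, for \<open>y\<close> itself.\<close>
  have "lev j \<subseteq> C y"
  proof (rule lev_C[OF assms(4)])
    show "lev (Suc j) \<subseteq> C y"
    proof
      fix a assume a: "a \<in> lev (Suc j)"
      then have "a \<in> lev j" using lev_Suc_subset by blast
      then have "y \<in> C a" using lev_C[OF _ lev_Suc_C[OF a]] assms(4) by blast
      then show "a \<in> C y" using C_sym[OF lev_tri[OF a] lev_tri[OF assms(4)]] by simp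
    qed
  qed
  then show ?thesis using assms(3) by (auto simp: C_def)
qed

end

section \<open>Passage to the quotient by N\<close>

theorem proposition1p10:
  fixes p n j :: nat and N :: "((nat \<Rightarrow> int) \<Rightarrow> (nat \<Rightarrow> int)) set"
  assumes "prime p" and "n \<ge> 1"
    and "N \<lhd> P p n" and "depth p n N = j"
  shows "derived (P p n) (T p n j) \<subseteq> N"
proof -
  interpret prime_power_points p n by unfold_locales (rule assms(1))
  interpret N: normal N "P p n" by (rule assms(3))
  interpret Q: group "P p n Mod N" by (rule N.factorgroup_is_group)
  have hom: "group_hom (P p n) (P p n Mod N) (\<lambda>x. N #>\<^bsub>P p n\<^esub> x)"
    by (intro group_hom.intro group_hom_axioms.intro N.r_coset_hom_Mod N.is_group Q.is_group)
  have j: "j \<le> n" and N: "N \<subseteq> lev j"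
    using subset_T_depth[OF N.subset] assms(4) by (auto simp: T_eq_lev)
  have comm: "N #>\<^bsub>P p n\<^esub> (x \<otimes>\<^bsub>B\<^esub> y) = N #>\<^bsub>P p n\<^esub> (y \<otimes>\<^bsub>B\<^esub> x)"
    if xy: "x \<in> lev j" "y \<in> lev j" for x y
  \<comment> \<open>For j = n there is no coordinate \<open>j\<close> to move, but T_n is
    trivial.\<close>
  proof (cases "j = n")
    case True
    then have "x = y" using xy lev_top by blast
    then show ?thesis by simp
  next
    case False
    \<comment> \<open>Suc j \<le> n lies in the range of the maximum defining the depth, so
      inclusion would contradict maximality.\<close>
    have "\<not> N \<subseteq> T p n (Suc j)"
    proof
      assume "N \<subseteq> T p n (Suc j)"
      then have "Suc j \<le> depth p n N"
        using False j unfolding depth_def by (intro Max_ge) auto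
      then show False using assms(4) by simp
    qed
    then obtain g v where g: "g \<in> N" "v \<in> X" "g v j \<noteq> v j"
      using N by (auto simp: T_eq_lev lev_def agree_Suc)
    have gl: "g \<in> lev j" using g N by blast
    have "(N #>\<^bsub>P p n\<^esub> x) \<otimes>\<^bsub>P p n Mod N\<^esub> (N #>\<^bsub>P p n\<^esub> y)
        = (N #>\<^bsub>P p n\<^esub> y) \<otimes>\<^bsub>P p n Mod N\<^esub> (N #>\<^bsub>P p n\<^esub> x)"
    proof (rule lev_commute_mod[OF hom _ xy])
      fix w assume w: "w \<in> X"
      obtain u where u: "u \<in> G" "u v = w" using transitive[OF g(2) w] by blast
      \<comment> \<open>Normality keeps the conjugate in N, and it moves coordinate \<open>j\<close>
        at \<open>w\<close> as \<open>g\<close> does at \<open>v\<close>.\<close>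
      let ?g = "u \<otimes>\<^bsub>B\<^esub> g \<otimes>\<^bsub>B\<^esub> inv\<^bsub>B\<^esub> u"
      have "inv\<^bsub>P p n\<^esub> u = inv\<^bsub>B\<^esub> u"
        using B.m_inv_consistent[OF subgroup_G u(1)] by (simp add: P_def)
      then have "?g \<in> N" using N.inv_op_closed2[OF u(1) g(1)] by (simp add: P_simps)
      moreover from this have "N #>\<^bsub>P p n\<^esub> ?g = \<one>\<^bsub>P p n Mod N\<^esub>"
        by (simp add: FactGroup_def N.rcos_const)
      moreover have "?g w j \<noteq> w j"
        using conj_moves[OF _ gl g(2,3)] u carrier_P by blast
      ultimately show "\<exists>g\<in>lev j. N #>\<^bsub>P p n\<^esub> g = \<one>\<^bsub>P p n Mod N\<^esub> \<and> g w j \<noteq> w j"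
        using N by blast
    qed
    then show ?thesis
      using xy by (simp add: FactGroup_def N.rcos_sum carrier_P lev_tri P_simps)
  qed
  have "x \<otimes>\<^bsub>P p n\<^esub> y \<otimes>\<^bsub>P p n\<^esub> inv\<^bsub>P p n\<^esub> x \<otimes>\<^bsub>P p n\<^esub> inv\<^bsub>P p n\<^esub> y \<in> N"
    if xy: "x \<in> lev j" "y \<in> lev j" for x y
  proof -
    have G: "x \<in> G" "y \<in> G" using xy by (auto simp: carrier_P lev_tri)
    \<comment> \<open>Equal cosets of \<open>x y\<close> and \<open>y x\<close> put the quotient of
      the two products, which is the commutator, into N.\<close>
    have "x \<otimes>\<^bsub>P p n\<^esub> y \<in> N #>\<^bsub>P p n\<^esub> (y \<otimes>\<^bsub>P p n\<^esub> x)"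
      using comm[OF xy] N.rcos_self[OF N.m_closed[OF G] N.subgroup_axioms] by (simp add: P_simps)
    then have "x \<otimes>\<^bsub>P p n\<^esub> y \<otimes>\<^bsub>P p n\<^esub> inv\<^bsub>P p n\<^esub> (y \<otimes>\<^bsub>P p n\<^esub> x) \<in> N"
      using G by (intro N.rcos_module_imp) auto
    then show ?thesis using G by (simp add: N.inv_mult_group N.m_assoc)
  qed
  then show ?thesis
    unfolding derived_def T_eq_lev
    by (intro N.generate_subgroup_incl N.subgroup_axioms) auto
qed

end
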